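(* For every odd prime $p$, the independence number of $G_p$ is $$\alpha(G_p)=\frac{(p-1)(p+1)^2}{4}.$$
   Context: For $n\ge2$, $\mathbb{L}_n=\{a+bi+cj+dk: a,b,c,d\in\mathbb{Z}/n\mathbb{Z}\}$ is the ring of Lipschitz quaternions modulo $n$, with the usual relations $i^2=j^2=k^2=-1$, $ij=k=-ji$, $jk=i=-kj$, $ki=j=-ik$ taken modulo $n$. A nonzero element $x$ of a ring is a zero divisor if $xy=0$ or $yx=0$ for some nonzero $y$. $G_n=\Gamma(\mathbb{L}_n)$ is the simple undirected graph whose vertices are the nonzero zero divisors of $\mathbb{L}_n$, distinct $x,y$ being adjacent iff $xy=0$ or $yx=0$. (For odd primes $p$, $\mathbb{L}_p\cong M_2(\mathbb{F}_p)$.) $\alpha(G)$ is the maximum order of a set of pairwise non-adjacent vertices of $G$. *)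

theory Defs
  imports "HOL-Number_Theory.Residues" "HOL-Library.Ramsey"
begin

text \<open>The quadruple \<open>(a, b, c, d)\<close> stands for $a + bi + cj + dk$.\<close>

definition quaternion_ring :: "('a, 'm) ring_scheme \<Rightarrow> ('a \<times> 'a \<times> 'a \<times> 'a) ring"
  where "quaternion_ring R =
    \<lparr>carrier = carrier R \<times> carrier R \<times> carrier R \<times> carrier R,
     monoid.mult = \<lambda>(a, b, c, d) (a', b', c', d').
       (a \<otimes>\<^bsub>R\<^esub> a' \<ominus>\<^bsub>R\<^esub> b \<otimes>\<^bsub>R\<^esub> b' \<ominus>\<^bsub>R\<^esub> c \<otimes>\<^bsub>R\<^esub> c' \<ominus>\<^bsub>R\<^esub> d \<otimes>\<^bsub>R\<^esub> d',
        a \<otimes>\<^bsub>R\<^esub> b' \<oplus>\<^bsub>R\<^esub> b \<otimes>\<^bsub>R\<^esub> a' \<oplus>\<^bsub>R\<^esub> c \<otimes>\<^bsub>R\<^esub> d' \<ominus>\<^bsub>R\<^esub> d \<otimes>\<^bsub>R\<^esub> c',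
        a \<otimes>\<^bsub>R\<^esub> c' \<ominus>\<^bsub>R\<^esub> b \<otimes>\<^bsub>R\<^esub> d' \<oplus>\<^bsub>R\<^esub> c \<otimes>\<^bsub>R\<^esub> a' \<oplus>\<^bsub>R\<^esub> d \<otimes>\<^bsub>R\<^esub> b',
        a \<otimes>\<^bsub>R\<^esub> d' \<oplus>\<^bsub>R\<^esub> b \<otimes>\<^bsub>R\<^esub> c' \<ominus>\<^bsub>R\<^esub> c \<otimes>\<^bsub>R\<^esub> b' \<oplus>\<^bsub>R\<^esub> d \<otimes>\<^bsub>R\<^esub> a'),
     one = (\<one>\<^bsub>R\<^esub>, \<zero>\<^bsub>R\<^esub>, \<zero>\<^bsub>R\<^esub>, \<zero>\<^bsub>R\<^esub>),
     zero = (\<zero>\<^bsub>R\<^esub>, \<zero>\<^bsub>R\<^esub>, \<zero>\<^bsub>R\<^esub>, \<zero>\<^bsub>R\<^esub>),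
     add = \<lambda>(a, b, c, d) (a', b', c', d').
       (a \<oplus>\<^bsub>R\<^esub> a', b \<oplus>\<^bsub>R\<^esub> b', c \<oplus>\<^bsub>R\<^esub> c', d \<oplus>\<^bsub>R\<^esub> d')\<rparr>"

definition lipschitz_ring :: "nat \<Rightarrow> (int \<times> int \<times> int \<times> int) ring"
  where "lipschitz_ring n = quaternion_ring (residue_ring (int n))"

definition zero_divisors :: "('a, 'm) ring_scheme \<Rightarrow> 'a set"
  where "zero_divisors R =
    {x \<in> carrier R - {\<zero>\<^bsub>R\<^esub>}.
       \<exists>y \<in> carrier R - {\<zero>\<^bsub>R\<^esub>}. x \<otimes>\<^bsub>R\<^esub> y = \<zero>\<^bsub>R\<^esub> \<or> y \<otimes>\<^bsub>R\<^esub> x = \<zero>\<^bsub>R\<^esub>}"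

definition zero_divisor_edges :: "('a, 'm) ring_scheme \<Rightarrow> 'a set set"
  where "zero_divisor_edges R =
    {{x, y} | x y. x \<in> zero_divisors R \<and> y \<in> zero_divisors R \<and> x \<noteq> y \<and>
       (x \<otimes>\<^bsub>R\<^esub> y = \<zero>\<^bsub>R\<^esub> \<or> y \<otimes>\<^bsub>R\<^esub> x = \<zero>\<^bsub>R\<^esub>)}"

text \<open>Intended for a finite vertex set \<open>V\<close>, where the maximum is taken over a finite set.\<close>

definition independence_number :: "'a set \<Rightarrow> 'a set set \<Rightarrow> nat"
  where "independence_number V E = Max (card ` {S. S \<subseteq> V \<and> indep S E})"

lemma (in cring) ring_quaternion_ring: "ring (quaternion_ring R)"
proof (rule ringI)
  show "abelian_group (quaternion_ring R)"
  proof (rule abelian_groupI)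
    fix x assume "x \<in> carrier (quaternion_ring R)"
    then obtain a b c d where x: "x = (a, b, c, d)"
      "a \<in> carrier R" "b \<in> carrier R" "c \<in> carrier R" "d \<in> carrier R"
      by (auto simp: quaternion_ring_def)
    then show "\<exists>y\<in>carrier (quaternion_ring R).
        y \<oplus>\<^bsub>quaternion_ring R\<^esub> x = \<zero>\<^bsub>quaternion_ring R\<^esub>"
      by (intro bexI[of _ "(\<ominus> a, \<ominus> b, \<ominus> c, \<ominus> d)"])
        (auto simp: quaternion_ring_def l_neg)
  qed (auto simp: quaternion_ring_def a_ac)
next
  show "Group.monoid (quaternion_ring R)"
    by (rule monoidI)
      (auto simp: quaternion_ring_def minus_eq l_distr r_distr l_minus r_minus minus_add a_ac m_assoc)
qed (auto simp: quaternion_ring_def minus_eq l_distr r_distr l_minus r_minus minus_add a_ac)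

lemma ring_lipschitz_ring:
  assumes "n \<ge> 2"
  shows "ring (lipschitz_ring n)"
proof -
  interpret residues "int n" "residue_ring (int n)"
    using assms by unfold_locales auto
  show ?thesis
    unfolding lipschitz_ring_def by (rule ring_quaternion_ring)
qed

lemma (in cring) quaternion_units:
  defines "Q \<equiv> quaternion_ring R"
    and "i \<equiv> (\<zero>, \<one>, \<zero>, \<zero>)" and "j \<equiv> (\<zero>, \<zero>, \<one>, \<zero>)" and "k \<equiv> (\<zero>, \<zero>, \<zero>, \<one>)"
    and "neg \<equiv> \<lambda>(a, b, c, d). (\<ominus> a, \<ominus> b, \<ominus> c, \<ominus> d)"
  shows "i \<otimes>\<^bsub>Q\<^esub> i = neg \<one>\<^bsub>Q\<^esub>" "j \<otimes>\<^bsub>Q\<^esub> j = neg \<one>\<^bsub>Q\<^esub>" "k \<otimes>\<^bsub>Q\<^esub> k = neg \<one>\<^bsub>Q\<^esub>"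
    and "i \<otimes>\<^bsub>Q\<^esub> j = k" "j \<otimes>\<^bsub>Q\<^esub> i = neg k"
    and "j \<otimes>\<^bsub>Q\<^esub> k = i" "k \<otimes>\<^bsub>Q\<^esub> j = neg i"
    and "k \<otimes>\<^bsub>Q\<^esub> i = j" "i \<otimes>\<^bsub>Q\<^esub> k = neg j"
  by (auto simp: assms quaternion_ring_def minus_eq)

end

theory Submission
  imports Defs "HOL-Decision_Procs.Algebra_Aux" "HOL-Algebra.QuotRing"
begin

text \<open>Over a finite field of odd order \<open>q\<close> the equation \<open>u\<^sup>2 + v\<^sup>2 = -1\<close> is solvable by counting squares
(\<open>sum_of_two_squares_eq_minus_one\<close>), and a solution identifies the quaternions with the
two-by-two matrices (\<open>quaternion_ring_iso_mat2_ring\<close>). The zero divisors of the matrix ring are the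
matrices of rank one. Such a matrix is determined by a nonzero scalar, its image and its kernel,
where the latter two are arbitrary points of the projective line with its \<open>q + 1\<close> points, and
\<open>x y = 0\<close> holds precisely when the kernel of \<open>x\<close> is the image of \<open>y\<close>
(\<open>zero_divisors_mat2_ring\<close>, \<open>rank_one_mult_eq_zero_iff\<close>).

This leaves a combinatorial problem (\<open>card_indep_meeting_le\<close>). In an independent set the images
and kernels used by the non-nilpotent members form disjoint sets of sizes \<open>a\<close> and \<open>b\<close>, which
allows at most \<open>(q - 1) a b\<close> such members. Nilpotent members have equal image and kernel; at most
one occurs for each line, and only for lines outside the first two sets. So \<open>n\<close> nilpotent members
force \<open>a + b + n \<le> q + 1\<close>, and \<open>(q - 1) a b + n\<close> is largest for \<open>n = 0\<close> and
\<open>a = b = (q + 1) / 2\<close>. Splitting the line into two halves, one for images and one for kernels,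
attains this value.\<close>

section \<open>Independent sets of image-kernel triples\<close>

text \<open>A triple \<open>(c, i, k)\<close> stands for a rank-one matrix with scalar factor \<open>c\<close>, image line \<open>i\<close> and
kernel line \<open>k\<close>. The product of two such matrices vanishes exactly when the kernel of the left
factor is the image of the right one, which is the adjacency encoded here.\<close>

definition meeting_edges :: "'c set \<Rightarrow> 'p set \<Rightarrow> ('c \<times> 'p \<times> 'p) set set"
  where "meeting_edges C P =
    {{(c, i, k), (c', i', k')} | c i k c' i' k'.
       c \<in> C \<and> c' \<in> C \<and> i \<in> P \<and> k \<in> P \<and> i' \<in> P \<and> k' \<in> P \<and>
       (c, i, k) \<noteq> (c', i', k') \<and> (k = i' \<or> k' = i)}"

lemma independence_number_bij:
  assumes f: "bij_betw f V W"
    and edge: "\<And>x y. x \<in> V \<Longrightarrow> y \<in> V \<Longrightarrow> x \<noteq> y \<Longrightarrow> {f x, f y} \<in> F \<longleftrightarrow> {x, y} \<in> E"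
  shows "independence_number W F = independence_number V E"
proof -
  have inj: "inj_on f V" and im: "f ` V = W"
    using f by (auto simp: bij_betw_def)
  have indep_iff: "indep (f ` S) F \<longleftrightarrow> indep S E" if "S \<subseteq> V" for S
  proof -
    have "f x \<noteq> f y \<and> {f x, f y} \<in> F \<longleftrightarrow> x \<noteq> y \<and> {x, y} \<in> E" if "x \<in> S" "y \<in> S" for x y
      using that \<open>S \<subseteq> V\<close> edge[of x y] inj_on_eq_iff[OF inj, of x y] by auto
    then show ?thesis unfolding indep_def by fast
  qed
  have "card ` {T. T \<subseteq> W \<and> indep T F} = (\<lambda>S. card (f ` S)) ` {S. S \<subseteq> V \<and> indep S E}"
  proof -
    have "{T. T \<subseteq> W \<and> indep T F} = (`) f ` {S. S \<subseteq> V \<and> indep S E}" (is "?L = ?R")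
    proof (intro equalityI subsetI)
      fix T assume "T \<in> ?L"
      then obtain S where "S \<subseteq> V" "T = f ` S" "indep T F"
        using im by (auto simp: subset_image_iff)
      then show "T \<in> ?R" using indep_iff by auto
    qed (use indep_iff im in auto)
    then show ?thesis by (simp add: image_image)
  qed
  also have "\<dots> = card ` {S. S \<subseteq> V \<and> indep S E}"
    using inj by (intro image_cong) (auto intro: card_image inj_on_subset)
  finally show ?thesis by (simp add: independence_number_def)
qed

text \<open>Trading the \<open>n\<close> extra points for points of the second factor costs nothing, since each of
them contributes \<open>m a \<ge> 1\<close> there; the product is then largest when the two factors
are balanced. If \<open>a = 0\<close>, only \<open>n \<le> 2 h\<close> remains.\<close>

lemma product_plus_le_square:
  fixes a b n h m :: nat
  assumes "a + b + n \<le> 2 * h" "2 \<le> m" "1 \<le> h"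
  shows "m * (a * b) + n \<le> m * h\<^sup>2"
proof (cases "a = 0")
  case True
  have "2 * h \<le> m * h\<^sup>2"
    using mult_mono[of 2 m h "h\<^sup>2"] assms by (simp add: power2_eq_square)
  then show ?thesis using True assms by simp
next
  case False
  have "n \<le> m * a * n" using False assms by simp
  then have "m * (a * b) + n \<le> m * (a * (b + n))" by (simp add: algebra_simps)
  also have "a * (b + n) \<le> h\<^sup>2"
  proof -
    have "4 * (a * (b + n)) \<le> (a + (b + n))\<^sup>2"
    proof -
      have "4 * (int a * int (b + n)) \<le> (int a + int (b + n))\<^sup>2"
        using zero_le_power2[of "int a - int (b + n)"]
        by (simp add: power2_eq_square algebra_simps)
      then have "int (4 * (a * (b + n))) \<le> int ((a + (b + n))\<^sup>2)" by simp
      then show ?thesis by (simp only: of_nat_le_iff)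
    qed
    also have "\<dots> \<le> (2 * h)\<^sup>2" using assms(1) by (intro power_mono) auto
    finally show ?thesis by (simp add: power2_eq_square)
  qed
  then have "m * (a * (b + n)) \<le> m * h\<^sup>2" by simp
  finally show ?thesis .
qed

text \<open>In an independent set the triples with \<open>i \<noteq> k\<close> (the non-nilpotent matrices) use images from a set
\<open>A\<close> and kernels from a set \<open>B\<close> which must be disjoint, so there are at most
\<open>card C * card A * card B\<close> of them. The triples with \<open>i = k\<close> on a given line are pairwise
adjacent, so each line carries at most one of them, and that line can lie neither in \<open>A\<close> nor in
\<open>B\<close>. Hence \<open>card A\<close>, \<open>card B\<close> and the number of these triples add up to at most \<open>card P\<close>.\<close>

lemma card_indep_meeting_le:
  assumes "finite C" "finite P" "2 \<le> card C" "card P = 2 * h" "1 \<le> h"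
    and S: "S \<subseteq> C \<times> P \<times> P" and indep: "indep S (meeting_edges C P)"
  shows "card S \<le> card C * h\<^sup>2"
proof -
  have fin: "finite S" using assms by (meson finite_SigmaI finite_subset)
  have apart: "k \<noteq> i'" if "(c, i, k) \<in> S" "(c', i', k') \<in> S" "(c, i, k) \<noteq> (c', i', k')"
    for c i k c' i' k'
  proof
    assume "k = i'"
    then have "{(c, i, k), (c', i', k')} \<in> meeting_edges C P"
      using that S unfolding meeting_edges_def by blast
    then show False using indep that unfolding indep_def by blast
  qed
  define N where "N = {x \<in> S. fst (snd x) = snd (snd x)}"
  define T where "T = S - N"
  define A where "A = (fst \<circ> snd) ` T"
  define B where "B = (snd \<circ> snd) ` T"
  define D where "D = (fst \<circ> snd) ` N"
  have "inj_on (fst \<circ> snd) N"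
  proof (rule inj_onI)
    fix x y assume xy: "x \<in> N" "y \<in> N" "(fst \<circ> snd) x = (fst \<circ> snd) y"
    obtain c i k c' i' k' where eq: "x = (c, i, k)" "y = (c', i', k')"
      by (metis prod_cases3)
    then have "k = i" "k' = i" "i' = i" "(c, i, i) \<in> S" "(c', i, i) \<in> S"
      using xy by (auto simp: N_def)
    then show "x = y" using apart[of c i i c' i i] eq by auto
  qed
  then have cD: "card D = card N" unfolding D_def by (rule card_image)
  have "T \<subseteq> C \<times> A \<times> B"
    using S unfolding T_def A_def B_def by force
  moreover have finAB: "finite A" "finite B" "finite D"
    using fin by (auto simp: A_def B_def D_def T_def N_def)
  ultimately have "card T \<le> card (C \<times> A \<times> B)"
    using \<open>finite C\<close> by (intro card_mono) auto
  then have cT: "card T \<le> card C * (card A * card B)"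
    by (simp add: card_cartesian_product)
  have A: "l \<in> A \<longleftrightarrow> (\<exists>c k. (c, l, k) \<in> S \<and> l \<noteq> k)"
    and B: "l \<in> B \<longleftrightarrow> (\<exists>c i. (c, i, l) \<in> S \<and> i \<noteq> l)"
    and D: "l \<in> D \<longleftrightarrow> (\<exists>c. (c, l, l) \<in> S)" for l
    unfolding A_def B_def D_def T_def N_def by force+
  have "A \<inter> B = {}" "D \<inter> A = {}" "D \<inter> B = {}"
    unfolding disjoint_iff A B D by (metis apart prod.inject)+
  then have "card A + card B + card D = card (A \<union> B \<union> D)"
    using finAB card_Un_disjoint[of A B] card_Un_disjoint[of "A \<union> B" D]
    by (simp add: Int_Un_distrib Int_Un_distrib2 Int_commute)
  also have "\<dots> \<le> card P"
    using S \<open>finite P\<close> unfolding A_def B_def D_def T_def N_def by (intro card_mono) auto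
  finally have "card A + card B + card N \<le> 2 * h" using assms cD by simp
  then have "card C * (card A * card B) + card N \<le> card C * h\<^sup>2"
    using assms by (intro product_plus_le_square) auto
  moreover have "card S = card T + card N"
    using fin by (simp add: T_def N_def card_Diff_subset card_mono)
  ultimately show ?thesis using cT by linarith
qed

text \<open>The bound is attained by splitting \<open>P\<close> into two halves and taking all triples with image in one
half and kernel in the other.\<close>

lemma independence_number_meeting_edges:
  assumes "finite C" "finite P" "2 \<le> card C" "card P = 2 * h" "1 \<le> h"
  shows "independence_number (C \<times> P \<times> P) (meeting_edges C P) = card C * h\<^sup>2"
proof -
  obtain A where A: "A \<subseteq> P" "card A = h"
    using obtain_subset_with_card_n[of h P] assms by auto
  let ?S = "C \<times> A \<times> (P - A)"
  have "card (P - A) = h" using A assms by (simp add: card_Diff_subset finite_subset)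
  then have "card ?S = card C * h\<^sup>2"
    using A by (simp add: card_cartesian_product power2_eq_square)
  moreover have "?S \<subseteq> C \<times> P \<times> P" using A by auto
  moreover have "indep ?S (meeting_edges C P)"
    unfolding indep_def meeting_edges_def by (auto simp: doubleton_eq_iff)
  ultimately have attained: "card C * h\<^sup>2 \<in> card ` {S. S \<subseteq> C \<times> P \<times> P \<and> indep S (meeting_edges C P)}"
    by (metis (mono_tags, lifting) image_eqI mem_Collect_eq)
  show ?thesis
    unfolding independence_number_def
  proof (rule Max_eqI)
    have "finite (C \<times> P \<times> P)" using assms by simp
    then show "finite (card ` {S. S \<subseteq> C \<times> P \<times> P \<and> indep S (meeting_edges C P)})"
      by simp
  qed (use attained card_indep_meeting_le assms in auto)
qed

section \<open>Quaternions as two-by-two matrices\<close>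

text \<open>The quadruple \<open>(a, b, c, d)\<close> stands for the matrix with rows \<open>(a, b)\<close> and \<open>(c, d)\<close>.\<close>

definition mat2_ring :: "('a, 'm) ring_scheme \<Rightarrow> ('a \<times> 'a \<times> 'a \<times> 'a) ring"
  where "mat2_ring R =
    \<lparr>carrier = carrier R \<times> carrier R \<times> carrier R \<times> carrier R,
     monoid.mult = \<lambda>(a, b, c, d) (a', b', c', d').
       (a \<otimes>\<^bsub>R\<^esub> a' \<oplus>\<^bsub>R\<^esub> b \<otimes>\<^bsub>R\<^esub> c', a \<otimes>\<^bsub>R\<^esub> b' \<oplus>\<^bsub>R\<^esub> b \<otimes>\<^bsub>R\<^esub> d',
        c \<otimes>\<^bsub>R\<^esub> a' \<oplus>\<^bsub>R\<^esub> d \<otimes>\<^bsub>R\<^esub> c', c \<otimes>\<^bsub>R\<^esub> b' \<oplus>\<^bsub>R\<^esub> d \<otimes>\<^bsub>R\<^esub> d'),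
     one = (\<one>\<^bsub>R\<^esub>, \<zero>\<^bsub>R\<^esub>, \<zero>\<^bsub>R\<^esub>, \<one>\<^bsub>R\<^esub>),
     zero = (\<zero>\<^bsub>R\<^esub>, \<zero>\<^bsub>R\<^esub>, \<zero>\<^bsub>R\<^esub>, \<zero>\<^bsub>R\<^esub>),
     add = \<lambda>(a, b, c, d) (a', b', c', d').
       (a \<oplus>\<^bsub>R\<^esub> a', b \<oplus>\<^bsub>R\<^esub> b', c \<oplus>\<^bsub>R\<^esub> c', d \<oplus>\<^bsub>R\<^esub> d')\<rparr>"

lemma (in cring) ring_mat2_ring: "ring (mat2_ring R)"
proof (rule ringI)
  show "abelian_group (mat2_ring R)"
  proof (rule abelian_groupI)
    fix x assume "x \<in> carrier (mat2_ring R)"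
    then obtain a b c d where x: "x = (a, b, c, d)"
      "a \<in> carrier R" "b \<in> carrier R" "c \<in> carrier R" "d \<in> carrier R"
      by (auto simp: mat2_ring_def)
    then show "\<exists>y\<in>carrier (mat2_ring R). y \<oplus>\<^bsub>mat2_ring R\<^esub> x = \<zero>\<^bsub>mat2_ring R\<^esub>"
      by (intro bexI[of _ "(\<ominus> a, \<ominus> b, \<ominus> c, \<ominus> d)"]) (auto simp: mat2_ring_def l_neg)
  qed (auto simp: mat2_ring_def a_ac)
next
  show "Group.monoid (mat2_ring R)"
    by (rule monoidI) (auto simp: mat2_ring_def l_distr r_distr a_ac m_assoc)
qed (auto simp: mat2_ring_def l_distr r_distr a_ac)

text \<open>For \<open>u\<^sup>2 + v\<^sup>2 = -1\<close> the images of \<open>i\<close>, \<open>j\<close> and \<open>k\<close> are the matrices with rows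
\<open>(0, 1), (-1, 0)\<close>, then \<open>(u, v), (v, -u)\<close>, then \<open>(v, -u), (-u, -v)\<close>. They have square \<open>-1\<close>
and multiply like the quaternion units.\<close>

definition (in ring) quat_to_mat :: "'a \<Rightarrow> 'a \<Rightarrow> 'a \<times> 'a \<times> 'a \<times> 'a \<Rightarrow> 'a \<times> 'a \<times> 'a \<times> 'a"
  where "quat_to_mat u v = (\<lambda>(a, b, c, d).
    (a \<oplus> (c \<otimes> u \<oplus> d \<otimes> v), b \<oplus> (c \<otimes> v \<ominus> d \<otimes> u),
     \<ominus> b \<oplus> (c \<otimes> v \<ominus> d \<otimes> u), a \<ominus> (c \<otimes> u \<oplus> d \<otimes> v)))"

text \<open>The inverse of \<open>quat_to_mat u v\<close> when \<open>h\<close> is one half: \<open>a\<close> and \<open>b\<close> come from the trace and the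
skew part, while \<open>c\<close> and \<open>d\<close> solve \<open>c u + d v = s\<close>, \<open>c v - d u = t\<close>, a linear system whose
determinant \<open>-(u\<^sup>2 + v\<^sup>2)\<close> is \<open>1\<close>.\<close>

definition (in ring) mat_to_quat :: "'a \<Rightarrow> 'a \<Rightarrow> 'a \<Rightarrow> 'a \<times> 'a \<times> 'a \<times> 'a \<Rightarrow> 'a \<times> 'a \<times> 'a \<times> 'a"
  where "mat_to_quat h u v = (\<lambda>(a, b, c, d).
    (h \<otimes> (a \<oplus> d), h \<otimes> (b \<ominus> c),
     \<ominus> (h \<otimes> (a \<ominus> d) \<otimes> u \<oplus> h \<otimes> (b \<oplus> c) \<otimes> v),
     \<ominus> (h \<otimes> (a \<ominus> d) \<otimes> v \<ominus> h \<otimes> (b \<oplus> c) \<otimes> u)))"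

text \<open>The linear map taking \<open>(c, d)\<close> to \<open>(c u + d v, c v - d u)\<close> multiplies inner products by
\<open>u\<^sup>2 + v\<^sup>2\<close> and, being a reflection up to that scaling, determinants by \<open>-(u\<^sup>2 + v\<^sup>2)\<close>.\<close>

lemma (in cring) two_square_similarity:
  assumes "u \<in> carrier R" "v \<in> carrier R" "c \<in> carrier R" "d \<in> carrier R"
    and "c' \<in> carrier R" "d' \<in> carrier R"
  shows "(c \<otimes> u \<oplus> d \<otimes> v) \<otimes> (c' \<otimes> u \<oplus> d' \<otimes> v) \<oplus> (c \<otimes> v \<ominus> d \<otimes> u) \<otimes> (c' \<otimes> v \<ominus> d' \<otimes> u)
      = (u \<otimes> u \<oplus> v \<otimes> v) \<otimes> (c \<otimes> c' \<oplus> d \<otimes> d')"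
    and "(c \<otimes> u \<oplus> d \<otimes> v) \<otimes> (c' \<otimes> v \<ominus> d' \<otimes> u) \<ominus> (c \<otimes> v \<ominus> d \<otimes> u) \<otimes> (c' \<otimes> u \<oplus> d' \<otimes> v)
      = (u \<otimes> u \<oplus> v \<otimes> v) \<otimes> (d \<otimes> c' \<ominus> c \<otimes> d')"
  using assms by algebra+

text \<open>For the same reason this map is its own inverse up to the factor \<open>u\<^sup>2 + v\<^sup>2\<close>, so its inverse is
its negative when that factor is \<open>-1\<close>.\<close>

lemma (in cring) two_square_involution:
  assumes "u \<in> carrier R" "v \<in> carrier R" "c \<in> carrier R" "d \<in> carrier R"
  shows "(c \<otimes> u \<oplus> d \<otimes> v) \<otimes> u \<oplus> (c \<otimes> v \<ominus> d \<otimes> u) \<otimes> v = (u \<otimes> u \<oplus> v \<otimes> v) \<otimes> c"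
    and "(c \<otimes> u \<oplus> d \<otimes> v) \<otimes> v \<ominus> (c \<otimes> v \<ominus> d \<otimes> u) \<otimes> u = (u \<otimes> u \<oplus> v \<otimes> v) \<otimes> d"
  using assms by algebra+

text \<open>Write \<open>f = c u + d v\<close> and \<open>g = c v - d u\<close>, so that the matrix has rows \<open>(a + f, b + g)\<close> and
\<open>(-b + g, a - f)\<close>. In a product of two such matrices \<open>c\<close>, \<open>d\<close> and their primed versions enter
quadratically only through \<open>f f' + g g'\<close> and \<open>f g' - g f'\<close>, and with \<open>u\<^sup>2 + v\<^sup>2 = -1\<close> these turn
into the terms \<open>-c c' - d d'\<close> and \<open>c d' - d c'\<close> of the quaternion product.\<close>

lemma (in cring) quat_to_mat_mult:
  assumes "u \<in> carrier R" "v \<in> carrier R" and uv: "u \<otimes> u \<oplus> v \<otimes> v = \<ominus> \<one>"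
    and "x \<in> carrier (quaternion_ring R)" "y \<in> carrier (quaternion_ring R)"
  shows "quat_to_mat u v (x \<otimes>\<^bsub>quaternion_ring R\<^esub> y)
       = quat_to_mat u v x \<otimes>\<^bsub>mat2_ring R\<^esub> quat_to_mat u v y"
proof -
  obtain a b c d a' b' c' d' where xy: "x = (a, b, c, d)" "y = (a', b', c', d')"
    and carr: "a \<in> carrier R" "b \<in> carrier R" "c \<in> carrier R" "d \<in> carrier R"
      "a' \<in> carrier R" "b' \<in> carrier R" "c' \<in> carrier R" "d' \<in> carrier R"
    using assms by (auto simp: quaternion_ring_def)
  let ?p = "a \<otimes> a' \<ominus> b \<otimes> b' \<ominus> c \<otimes> c' \<ominus> d \<otimes> d'"
  let ?q = "a \<otimes> b' \<oplus> b \<otimes> a' \<oplus> c \<otimes> d' \<ominus> d \<otimes> c'"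
  let ?r = "a \<otimes> c' \<ominus> b \<otimes> d' \<oplus> c \<otimes> a' \<oplus> d \<otimes> b'"
  let ?s = "a \<otimes> d' \<oplus> b \<otimes> c' \<ominus> c \<otimes> b' \<oplus> d \<otimes> a'"
  define f where "f = c \<otimes> u \<oplus> d \<otimes> v"
  define g where "g = c \<otimes> v \<ominus> d \<otimes> u"
  define f' where "f' = c' \<otimes> u \<oplus> d' \<otimes> v"
  define g' where "g' = c' \<otimes> v \<ominus> d' \<otimes> u"
  have fg: "f \<in> carrier R" "g \<in> carrier R" "f' \<in> carrier R" "g' \<in> carrier R"
    using assms carr by (simp_all add: f_def g_def f'_def g'_def)
  have ru: "?r \<otimes> u \<oplus> ?s \<otimes> v = a \<otimes> f' \<oplus> f \<otimes> a' \<oplus> b \<otimes> g' \<ominus> g \<otimes> b'"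
    unfolding f_def g_def f'_def g'_def using assms(1,2) carr by algebra
  have rv: "?r \<otimes> v \<ominus> ?s \<otimes> u = a \<otimes> g' \<oplus> g \<otimes> a' \<ominus> b \<otimes> f' \<oplus> f \<otimes> b'"
    unfolding f_def g_def f'_def g'_def using assms(1,2) carr by algebra
  have "f \<otimes> f' \<oplus> g \<otimes> g' = \<ominus> (c \<otimes> c' \<oplus> d \<otimes> d')"
    unfolding f_def g_def f'_def g'_def
    using two_square_similarity(1)[of u v c d c' d'] assms(1,2) carr by (simp add: uv l_minus)
  then have "?p = a \<otimes> a' \<ominus> b \<otimes> b' \<oplus> (f \<otimes> f' \<oplus> g \<otimes> g')"
    using carr by (simp add: minus_eq minus_add a_assoc)
  moreover have "f \<otimes> g' \<ominus> g \<otimes> f' = \<ominus> (d \<otimes> c' \<ominus> c \<otimes> d')"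
    unfolding f_def g_def f'_def g'_def
    using two_square_similarity(2)[of u v c d c' d'] assms(1,2) carr by (simp add: uv l_minus)
  then have "?q = a \<otimes> b' \<oplus> b \<otimes> a' \<oplus> (f \<otimes> g' \<ominus> g \<otimes> f')"
    using carr by (simp add: minus_eq minus_add a_ac)
  moreover have "(a \<oplus> f) \<otimes> (a' \<oplus> f') \<oplus> (b \<oplus> g) \<otimes> (\<ominus> b' \<oplus> g')
      = a \<otimes> a' \<ominus> b \<otimes> b' \<oplus> (f \<otimes> f' \<oplus> g \<otimes> g') \<oplus> (a \<otimes> f' \<oplus> f \<otimes> a' \<oplus> b \<otimes> g' \<ominus> g \<otimes> b')"
    using carr fg by algebra
  moreover have "(a \<oplus> f) \<otimes> (b' \<oplus> g') \<oplus> (b \<oplus> g) \<otimes> (a' \<ominus> f')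
      = a \<otimes> b' \<oplus> b \<otimes> a' \<oplus> (f \<otimes> g' \<ominus> g \<otimes> f') \<oplus> (a \<otimes> g' \<oplus> g \<otimes> a' \<ominus> b \<otimes> f' \<oplus> f \<otimes> b')"
    using carr fg by algebra
  moreover have "(\<ominus> b \<oplus> g) \<otimes> (a' \<oplus> f') \<oplus> (a \<ominus> f) \<otimes> (\<ominus> b' \<oplus> g')
      = \<ominus> (a \<otimes> b' \<oplus> b \<otimes> a' \<oplus> (f \<otimes> g' \<ominus> g \<otimes> f')) \<oplus> (a \<otimes> g' \<oplus> g \<otimes> a' \<ominus> b \<otimes> f' \<oplus> f \<otimes> b')"
    using carr fg by algebra
  moreover have "(\<ominus> b \<oplus> g) \<otimes> (b' \<oplus> g') \<oplus> (a \<ominus> f) \<otimes> (a' \<ominus> f')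
      = a \<otimes> a' \<ominus> b \<otimes> b' \<oplus> (f \<otimes> f' \<oplus> g \<otimes> g') \<ominus> (a \<otimes> f' \<oplus> f \<otimes> a' \<oplus> b \<otimes> g' \<ominus> g \<otimes> b')"
    using carr fg by algebra
  ultimately show ?thesis
    by (simp only: xy quat_to_mat_def mat2_ring_def quaternion_ring_def ru rv
        split_conv monoid.simps ring.simps partial_object.simps
        f_def[symmetric] g_def[symmetric] f'_def[symmetric] g'_def[symmetric])
qed

text \<open>These are the sums and differences of matrix entries that occur when the two coordinate changes
are composed, in either order and for the diagonal as well as the off-diagonal entries.\<close>

lemma (in cring) half_sum_and_difference:
  assumes carr: "h \<in> carrier R" "x \<in> carrier R" "y \<in> carrier R" and h: "h \<oplus> h = \<one>"
  shows "h \<otimes> (x \<oplus> y \<oplus> (x \<ominus> y)) = x" "h \<otimes> (x \<oplus> y \<ominus> (x \<ominus> y)) = y"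
    and "h \<otimes> (x \<oplus> y \<ominus> (\<ominus> x \<oplus> y)) = x" "h \<otimes> (x \<oplus> y \<oplus> (\<ominus> x \<oplus> y)) = y"
    and "h \<otimes> (x \<oplus> y) \<oplus> h \<otimes> (x \<ominus> y) = x" "h \<otimes> (x \<oplus> y) \<ominus> h \<otimes> (x \<ominus> y) = y"
    and "h \<otimes> (x \<ominus> y) \<oplus> h \<otimes> (x \<oplus> y) = x" "\<ominus> (h \<otimes> (x \<ominus> y)) \<oplus> h \<otimes> (x \<oplus> y) = y"
proof -
  have "h \<otimes> (x \<oplus> y \<oplus> (x \<ominus> y)) = (h \<oplus> h) \<otimes> x" "h \<otimes> (x \<oplus> y \<ominus> (x \<ominus> y)) = (h \<oplus> h) \<otimes> y"
    "h \<otimes> (x \<oplus> y \<ominus> (\<ominus> x \<oplus> y)) = (h \<oplus> h) \<otimes> x" "h \<otimes> (x \<oplus> y \<oplus> (\<ominus> x \<oplus> y)) = (h \<oplus> h) \<otimes> y"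
    "h \<otimes> (x \<oplus> y) \<oplus> h \<otimes> (x \<ominus> y) = (h \<oplus> h) \<otimes> x" "h \<otimes> (x \<oplus> y) \<ominus> h \<otimes> (x \<ominus> y) = (h \<oplus> h) \<otimes> y"
    "h \<otimes> (x \<ominus> y) \<oplus> h \<otimes> (x \<oplus> y) = (h \<oplus> h) \<otimes> x" "\<ominus> (h \<otimes> (x \<ominus> y)) \<oplus> h \<otimes> (x \<oplus> y) = (h \<oplus> h) \<otimes> y"
    using carr by algebra+
  then show "h \<otimes> (x \<oplus> y \<oplus> (x \<ominus> y)) = x" "h \<otimes> (x \<oplus> y \<ominus> (x \<ominus> y)) = y"
    "h \<otimes> (x \<oplus> y \<ominus> (\<ominus> x \<oplus> y)) = x" "h \<otimes> (x \<oplus> y \<oplus> (\<ominus> x \<oplus> y)) = y"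
    "h \<otimes> (x \<oplus> y) \<oplus> h \<otimes> (x \<ominus> y) = x" "h \<otimes> (x \<oplus> y) \<ominus> h \<otimes> (x \<ominus> y) = y"
    "h \<otimes> (x \<ominus> y) \<oplus> h \<otimes> (x \<oplus> y) = x" "\<ominus> (h \<otimes> (x \<ominus> y)) \<oplus> h \<otimes> (x \<oplus> y) = y"
    using carr by (simp_all add: h)
qed

lemma (in cring) quat_to_mat_inverse:
  assumes carr: "u \<in> carrier R" "v \<in> carrier R" "h \<in> carrier R"
    and uv: "u \<otimes> u \<oplus> v \<otimes> v = \<ominus> \<one>" and h: "h \<oplus> h = \<one>"
    and abcd: "a \<in> carrier R" "b \<in> carrier R" "c \<in> carrier R" "d \<in> carrier R"
  shows "mat_to_quat h u v (quat_to_mat u v (a, b, c, d)) = (a, b, c, d)"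
    and "quat_to_mat u v (mat_to_quat h u v (a, b, c, d)) = (a, b, c, d)"
proof -
  have invol: "\<ominus> ((s \<otimes> u \<oplus> t \<otimes> v) \<otimes> u \<oplus> (s \<otimes> v \<ominus> t \<otimes> u) \<otimes> v) = s"
    "\<ominus> ((s \<otimes> u \<oplus> t \<otimes> v) \<otimes> v \<ominus> (s \<otimes> v \<ominus> t \<otimes> u) \<otimes> u) = t"
    if "s \<in> carrier R" "t \<in> carrier R" for s t
    using that carr by (simp_all add: two_square_involution uv l_minus)
  have "c \<otimes> u \<oplus> d \<otimes> v \<in> carrier R" "c \<otimes> v \<ominus> d \<otimes> u \<in> carrier R"
    using carr abcd by simp_all
  then show "mat_to_quat h u v (quat_to_mat u v (a, b, c, d)) = (a, b, c, d)"
    using carr abcd h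
    by (simp only: quat_to_mat_def mat_to_quat_def split_conv half_sum_and_difference invol)
  have neg: "\<ominus> x \<otimes> u \<oplus> \<ominus> y \<otimes> v = \<ominus> (x \<otimes> u \<oplus> y \<otimes> v)"
    "\<ominus> x \<otimes> v \<ominus> \<ominus> y \<otimes> u = \<ominus> (x \<otimes> v \<ominus> y \<otimes> u)"
    if "x \<in> carrier R" "y \<in> carrier R" for x y
    using that carr by (simp_all add: l_minus minus_eq minus_add)
  define s where "s = h \<otimes> (a \<ominus> d)"
  define t where "t = h \<otimes> (b \<oplus> c)"
  have st: "s \<in> carrier R" "t \<in> carrier R" using carr abcd by (simp_all add: s_def t_def)
  have "\<ominus> (s \<otimes> u \<oplus> t \<otimes> v) \<otimes> u \<oplus> \<ominus> (s \<otimes> v \<ominus> t \<otimes> u) \<otimes> v = s"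
    "\<ominus> (s \<otimes> u \<oplus> t \<otimes> v) \<otimes> v \<ominus> \<ominus> (s \<otimes> v \<ominus> t \<otimes> u) \<otimes> u = t"
    using invol[OF st] neg[of "s \<otimes> u \<oplus> t \<otimes> v" "s \<otimes> v \<ominus> t \<otimes> u"] st carr by simp_all
  then show "quat_to_mat u v (mat_to_quat h u v (a, b, c, d)) = (a, b, c, d)"
    using half_sum_and_difference[OF carr(3) abcd(1,4) h] half_sum_and_difference[OF carr(3) abcd(2,3) h]
    by (simp add: quat_to_mat_def mat_to_quat_def flip: s_def t_def)
qed

text \<open>A solution of \<open>u\<^sup>2 + v\<^sup>2 = -1\<close> splits the quaternion algebra outside characteristic two.\<close>

lemma (in field) quaternion_ring_iso_mat2_ring:
  assumes uv: "u \<in> carrier R" "v \<in> carrier R" "u \<otimes> u \<oplus> v \<otimes> v = \<ominus> \<one>"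
    and two: "\<one> \<oplus> \<one> \<noteq> \<zero>"
  shows "quat_to_mat u v \<in> ring_iso (quaternion_ring R) (mat2_ring R)"
proof (rule ring_iso_memI)
  define h where "h = inv (\<one> \<oplus> \<one>)"
  have h: "h \<in> carrier R" using two by (simp add: h_def)
  have "h \<otimes> (\<one> \<oplus> \<one>) = \<one>" using two by (simp add: h_def)
  then have h2: "h \<oplus> h = \<one>" using h by (simp add: r_distr)
  show closed: "quat_to_mat u v x \<in> carrier (mat2_ring R)" if "x \<in> carrier (quaternion_ring R)" for x
    using that uv by (auto simp: quat_to_mat_def mat2_ring_def quaternion_ring_def)
  show "quat_to_mat u v (x \<otimes>\<^bsub>quaternion_ring R\<^esub> y)
      = quat_to_mat u v x \<otimes>\<^bsub>mat2_ring R\<^esub> quat_to_mat u v y"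
    if "x \<in> carrier (quaternion_ring R)" "y \<in> carrier (quaternion_ring R)" for x y
    using quat_to_mat_mult uv that by simp
  show "quat_to_mat u v (x \<oplus>\<^bsub>quaternion_ring R\<^esub> y)
      = quat_to_mat u v x \<oplus>\<^bsub>mat2_ring R\<^esub> quat_to_mat u v y"
    if "x \<in> carrier (quaternion_ring R)" "y \<in> carrier (quaternion_ring R)" for x y
    using that uv
    by (auto simp: quat_to_mat_def mat2_ring_def quaternion_ring_def minus_eq l_distr minus_add a_ac)
  show "quat_to_mat u v \<one>\<^bsub>quaternion_ring R\<^esub> = \<one>\<^bsub>mat2_ring R\<^esub>"
    using uv by (simp add: quat_to_mat_def mat2_ring_def quaternion_ring_def)
  show "bij_betw (quat_to_mat u v) (carrier (quaternion_ring R)) (carrier (mat2_ring R))"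
  proof (rule bij_betw_byWitness[where f' = "mat_to_quat h u v"])
    show "quat_to_mat u v ` carrier (quaternion_ring R) \<subseteq> carrier (mat2_ring R)"
      using closed by blast
    show "mat_to_quat h u v ` carrier (mat2_ring R) \<subseteq> carrier (quaternion_ring R)"
      using uv h by (auto simp: mat_to_quat_def mat2_ring_def quaternion_ring_def)
  qed (use quat_to_mat_inverse uv h h2 in \<open>auto simp: mat2_ring_def quaternion_ring_def\<close>)
qed

section \<open>Finite fields of odd order\<close>

text \<open>Each fibre of squaring has at most two elements and the order is odd, so more than half of the
elements of the field are squares. The set \<open>S\<close> of squares therefore meets \<open>N = {-(s + 1) | s \<in> S}\<close>, which has the
same size.\<close>

lemma (in field) sum_of_two_squares_eq_minus_one:
  assumes fin: "finite (carrier R)" and odd: "odd (card (carrier R))"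
  obtains u v where "u \<in> carrier R" "v \<in> carrier R" "u \<otimes> u \<oplus> v \<otimes> v = \<ominus> \<one>"
proof -
  define S where "S = (\<lambda>x. x \<otimes> x) ` carrier R"
  define N where "N = (\<lambda>s. \<ominus> (s \<oplus> \<one>)) ` S"
  have S: "finite S" "S \<subseteq> carrier R" using fin by (auto simp: S_def)
  have "card (carrier R) \<le> card (\<Union>s\<in>S. {x \<in> carrier R. x \<otimes> x = s})"
    using fin S(1) by (intro card_mono) (auto simp: S_def)
  also have "\<dots> \<le> (\<Sum>s\<in>S. card {x \<in> carrier R. x \<otimes> x = s})"
    using S(1) by (rule card_UN_le)
  also have "\<dots> \<le> (\<Sum>s\<in>S. 2)"
  proof (rule sum_mono)
    fix s assume "s \<in> S"
    then obtain y where y: "y \<in> carrier R" "s = y \<otimes> y" by (auto simp: S_def)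
    have "{x \<in> carrier R. x \<otimes> x = s} \<subseteq> {y, \<ominus> y}"
      using y square_eq_iff by auto
    then have "card {x \<in> carrier R. x \<otimes> x = s} \<le> card {y, \<ominus> y}"
      by (intro card_mono) auto
    also have "\<dots> \<le> 2" by (simp add: card_insert_if)
    finally show "card {x \<in> carrier R. x \<otimes> x = s} \<le> 2" .
  qed
  finally have "card (carrier R) \<le> 2 * card S" by simp
  then have "card (carrier R) < card S + card S" using odd by (cases "card (carrier R) = 2 * card S") auto
  moreover have "card N = card S"
    unfolding N_def
  proof (intro card_image inj_onI)
    fix s t assume "s \<in> S" "t \<in> S" and eq: "\<ominus> (s \<oplus> \<one>) = \<ominus> (t \<oplus> \<one>)"
    then have "s \<in> carrier R" "t \<in> carrier R" using S(2) by auto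
    then show "s = t" using eq by (simp add: neg_equal_iff_equal)
  qed
  moreover have N: "finite N" "N \<subseteq> carrier R" using S by (auto simp: N_def)
  ultimately have "card (carrier R) < card S + card N" by simp
  have "S \<inter> N \<noteq> {}"
  proof
    assume "S \<inter> N = {}"
    then have "card S + card N = card (S \<union> N)"
      using S(1) N(1) by (simp add: card_Un_disjoint)
    also have "\<dots> \<le> card (carrier R)" using fin S(2) N(2) by (intro card_mono) auto
    finally show False using \<open>card (carrier R) < card S + card N\<close> by simp
  qed
  then obtain u v where "u \<in> carrier R" "v \<in> carrier R" "u \<otimes> u = \<ominus> (v \<otimes> v \<oplus> \<one>)"
    by (auto simp: S_def N_def)
  moreover from this have "u \<otimes> u \<oplus> v \<otimes> v = \<ominus> \<one>" by algebra
  ultimately show thesis using that by blast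
qed

text \<open>In characteristic two every even multiple of \<open>1\<close> vanishes, but by Lagrange so does the multiple
by the odd order of the additive group, and the two differ by \<open>1\<close>.\<close>

lemma (in field) two_nonzero_of_odd_card:
  assumes "odd (card (carrier R))"
  shows "\<one> \<oplus> \<one> \<noteq> \<zero>"
proof
  assume two: "\<one> \<oplus> \<one> = \<zero>"
  have even: "[(2 * k)] \<cdot> \<one> = \<zero>" for k :: nat
    by (induction k) (simp_all add: two a_assoc)
  obtain k where k: "card (carrier R) = 2 * k + 1" using assms by (rule oddE)
  have "[card (carrier R)] \<cdot> \<one> = \<zero>"
    using group.pow_order_eq_1[OF a_group, of \<one>] by (simp add: add_pow_def order_def)
  then show False using even[of k] by (simp add: k)
qed

section \<open>Singular matrices and points of the projective line\<close>

text \<open>The projective line: \<open>Some t\<close> is the line spanned by \<open>(1, t)\<close>, and \<open>None\<close> the line spanned by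
\<open>(0, 1)\<close>.\<close>

definition proj_line :: "('a, 'm) ring_scheme \<Rightarrow> 'a option set"
  where "proj_line R = insert None (Some ` carrier R)"

definition (in ring) direction :: "'a option \<Rightarrow> 'a \<times> 'a"
  where "direction i = (case i of None \<Rightarrow> (\<zero>, \<one>) | Some t \<Rightarrow> (\<one>, t))"

text \<open>A row vector whose kernel is the line named by the argument. With this choice the same parameter
set names images and kernels.\<close>

definition (in ring) annihilator :: "'a option \<Rightarrow> 'a \<times> 'a"
  where "annihilator i = (case i of None \<Rightarrow> (\<one>, \<zero>) | Some t \<Rightarrow> (t, \<ominus> \<one>))"

text \<open>The matrix \<open>c v w\<close> with \<open>v\<close> the column spanning \<open>i\<close> and \<open>w\<close> the row annihilating \<open>k\<close>; it has
image \<open>i\<close> and kernel \<open>k\<close> when \<open>c \<noteq> 0\<close>.\<close>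

definition (in ring) rank_one :: "'a \<times> 'a option \<times> 'a option \<Rightarrow> 'a \<times> 'a \<times> 'a \<times> 'a"
  where "rank_one = (\<lambda>(c, i, k). case (direction i, annihilator k) of ((v\<^sub>1, v\<^sub>2), (w\<^sub>1, w\<^sub>2)) \<Rightarrow>
    (c \<otimes> (v\<^sub>1 \<otimes> w\<^sub>1), c \<otimes> (v\<^sub>1 \<otimes> w\<^sub>2), c \<otimes> (v\<^sub>2 \<otimes> w\<^sub>1), c \<otimes> (v\<^sub>2 \<otimes> w\<^sub>2)))"

lemma (in cring) card_proj_line:
  "finite (carrier R) \<Longrightarrow> card (proj_line R) = card (carrier R) + 1"
  by (simp add: proj_line_def card_image)

lemma (in field) directionE:
  assumes "i \<in> proj_line R"
  obtains v\<^sub>1 v\<^sub>2 where "direction i = (v\<^sub>1, v\<^sub>2)" "v\<^sub>1 \<in> carrier R" "v\<^sub>2 \<in> carrier R"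
    "v\<^sub>1 \<noteq> \<zero> \<or> v\<^sub>2 \<noteq> \<zero>"
proof (cases i)
  case None
  then show ?thesis using that[of \<zero> \<one>] by (simp add: direction_def)
next
  case (Some t)
  then have "t \<in> carrier R" using assms by (auto simp: proj_line_def)
  then show ?thesis using that[of \<one> t] Some by (simp add: direction_def)
qed

lemma (in field) uminus_one_nonzero: "\<ominus> \<one> \<noteq> \<zero>"
  using neg_equal_swap[of \<one> \<zero>] by simp

lemma (in field) annihilatorE:
  assumes "k \<in> proj_line R"
  obtains w\<^sub>1 w\<^sub>2 where "annihilator k = (w\<^sub>1, w\<^sub>2)" "w\<^sub>1 \<in> carrier R" "w\<^sub>2 \<in> carrier R"
    "w\<^sub>1 \<noteq> \<zero> \<or> w\<^sub>2 \<noteq> \<zero>"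
proof (cases k)
  case None
  then show ?thesis using that[of \<one> \<zero>] by (simp add: annihilator_def)
next
  case (Some t)
  then have "t \<in> carrier R" using assms by (auto simp: proj_line_def)
  then show ?thesis using that[of t "\<ominus> \<one>"] Some uminus_one_nonzero by (simp add: annihilator_def)
qed

lemma (in field) annihilator_direction_eq_zero_iff:
  assumes "k \<in> proj_line R" "i \<in> proj_line R"
    and "annihilator k = (w\<^sub>1, w\<^sub>2)" "direction i = (v\<^sub>1, v\<^sub>2)"
  shows "w\<^sub>1 \<otimes> v\<^sub>1 \<oplus> w\<^sub>2 \<otimes> v\<^sub>2 = \<zero> \<longleftrightarrow> k = i"
proof (cases k)
  case None
  then show ?thesis
    using assms by (cases i) (auto simp: proj_line_def direction_def annihilator_def)
next
  case (Some t)
  then have t: "t \<in> carrier R" using assms by (auto simp: proj_line_def)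
  show ?thesis
  proof (cases i)
    case None
    then show ?thesis using Some t assms(3,4) uminus_one_nonzero
      by (auto simp: direction_def annihilator_def)
  next
    case i: (Some s)
    then have s: "s \<in> carrier R" using assms by (auto simp: proj_line_def)
    have "t \<oplus> \<ominus> s = \<zero> \<longleftrightarrow> t = s" using eq_diff0[OF t s] by (simp only: minus_eq)
    then show ?thesis using Some i s t assms(3,4)
      by (auto simp: direction_def annihilator_def l_minus)
  qed
qed

lemma (in field) rank_one_closed:
  assumes "c \<in> carrier R" "i \<in> proj_line R" "k \<in> proj_line R"
  shows "rank_one (c, i, k) \<in> carrier (mat2_ring R)"
proof -
  obtain v\<^sub>1 v\<^sub>2 where "direction i = (v\<^sub>1, v\<^sub>2)" "v\<^sub>1 \<in> carrier R" "v\<^sub>2 \<in> carrier R"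
    by (rule directionE[OF assms(2)])
  moreover obtain w\<^sub>1 w\<^sub>2 where "annihilator k = (w\<^sub>1, w\<^sub>2)" "w\<^sub>1 \<in> carrier R" "w\<^sub>2 \<in> carrier R"
    by (rule annihilatorE[OF assms(3)])
  ultimately show ?thesis using assms(1) by (simp add: rank_one_def mat2_ring_def)
qed

lemma (in field) rank_one_nonzero:
  assumes "c \<in> carrier R - {\<zero>}" "i \<in> proj_line R" "k \<in> proj_line R"
  shows "rank_one (c, i, k) \<noteq> \<zero>\<^bsub>mat2_ring R\<^esub>"
proof -
  obtain v\<^sub>1 v\<^sub>2 where "direction i = (v\<^sub>1, v\<^sub>2)" "v\<^sub>1 \<in> carrier R" "v\<^sub>2 \<in> carrier R"
    "v\<^sub>1 \<noteq> \<zero> \<or> v\<^sub>2 \<noteq> \<zero>" by (rule directionE[OF assms(2)])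
  moreover obtain w\<^sub>1 w\<^sub>2 where "annihilator k = (w\<^sub>1, w\<^sub>2)" "w\<^sub>1 \<in> carrier R" "w\<^sub>2 \<in> carrier R"
    "w\<^sub>1 \<noteq> \<zero> \<or> w\<^sub>2 \<noteq> \<zero>" by (rule annihilatorE[OF assms(3)])
  ultimately show ?thesis using assms(1)
    by (auto simp: rank_one_def mat2_ring_def integral_iff)
qed

text \<open>By associativity \<open>(c v w) (c' x y) = (c c' (w x)) v y\<close>, where \<open>w x\<close> is a scalar that vanishes
exactly when \<open>x\<close> lies on the line annihilated by \<open>w\<close>.\<close>

lemma (in field) rank_one_mult_eq_zero_iff:
  assumes c: "c \<in> carrier R - {\<zero>}" "c' \<in> carrier R - {\<zero>}"
    and "i \<in> proj_line R" "k \<in> proj_line R" "i' \<in> proj_line R" "k' \<in> proj_line R"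
  shows "rank_one (c, i, k) \<otimes>\<^bsub>mat2_ring R\<^esub> rank_one (c', i', k') = \<zero>\<^bsub>mat2_ring R\<^esub> \<longleftrightarrow> k = i'"
proof -
  obtain v\<^sub>1 v\<^sub>2 where v: "direction i = (v\<^sub>1, v\<^sub>2)" "v\<^sub>1 \<in> carrier R" "v\<^sub>2 \<in> carrier R"
    "v\<^sub>1 \<noteq> \<zero> \<or> v\<^sub>2 \<noteq> \<zero>" by (rule directionE[OF assms(3)])
  obtain w\<^sub>1 w\<^sub>2 where w: "annihilator k = (w\<^sub>1, w\<^sub>2)" "w\<^sub>1 \<in> carrier R" "w\<^sub>2 \<in> carrier R"
    by (rule annihilatorE[OF assms(4)])
  obtain x\<^sub>1 x\<^sub>2 where x: "direction i' = (x\<^sub>1, x\<^sub>2)" "x\<^sub>1 \<in> carrier R" "x\<^sub>2 \<in> carrier R"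
    by (rule directionE[OF assms(5)])
  obtain y\<^sub>1 y\<^sub>2 where y: "annihilator k' = (y\<^sub>1, y\<^sub>2)" "y\<^sub>1 \<in> carrier R" "y\<^sub>2 \<in> carrier R"
    "y\<^sub>1 \<noteq> \<zero> \<or> y\<^sub>2 \<noteq> \<zero>" by (rule annihilatorE[OF assms(6)])
  define e where "e = c \<otimes> c' \<otimes> (w\<^sub>1 \<otimes> x\<^sub>1 \<oplus> w\<^sub>2 \<otimes> x\<^sub>2)"
  have e: "e \<in> carrier R" "e = \<zero> \<longleftrightarrow> k = i'"
    using c w x annihilator_direction_eq_zero_iff[OF assms(4,5) w(1) x(1)]
    by (auto simp: e_def integral_iff)
  have entry: "(c \<otimes> (s \<otimes> w\<^sub>1)) \<otimes> (c' \<otimes> (x\<^sub>1 \<otimes> t)) \<oplus> (c \<otimes> (s \<otimes> w\<^sub>2)) \<otimes> (c' \<otimes> (x\<^sub>2 \<otimes> t))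
      = e \<otimes> (s \<otimes> t)" if "s \<in> carrier R" "t \<in> carrier R" for s t
    using that c w x by (simp add: e_def l_distr r_distr m_ac)
  have "rank_one (c, i, k) \<otimes>\<^bsub>mat2_ring R\<^esub> rank_one (c', i', k')
      = (e \<otimes> (v\<^sub>1 \<otimes> y\<^sub>1), e \<otimes> (v\<^sub>1 \<otimes> y\<^sub>2), e \<otimes> (v\<^sub>2 \<otimes> y\<^sub>1), e \<otimes> (v\<^sub>2 \<otimes> y\<^sub>2))"
    using v(2,3) y(2,3) by (simp add: rank_one_def mat2_ring_def v(1) w(1) x(1) y(1) entry)
  then show ?thesis using e v y by (auto simp: mat2_ring_def integral_iff)
qed

text \<open>The lines are recovered from the matrix because the vanishing of products detects them: the
kernel by multiplying on the right with a test matrix, the image by multiplying on the left. The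
scalar is then read off from any nonzero entry.\<close>

lemma (in field) inj_on_rank_one:
  "inj_on rank_one ((carrier R - {\<zero>}) \<times> proj_line R \<times> proj_line R)"
proof (rule inj_onI)
  fix x y
  assume xy: "x \<in> (carrier R - {\<zero>}) \<times> proj_line R \<times> proj_line R"
    "y \<in> (carrier R - {\<zero>}) \<times> proj_line R \<times> proj_line R" "rank_one x = rank_one y"
  obtain c i k c' i' k' where x: "x = (c, i, k)" and y: "y = (c', i', k')" by (metis prod_cases3)
  have eq: "rank_one (c, i, k) = rank_one (c', i', k')"
    and c: "c \<in> carrier R" "c \<noteq> \<zero>" "c' \<in> carrier R" "c' \<noteq> \<zero>"
    and P: "i \<in> proj_line R" "k \<in> proj_line R" "i' \<in> proj_line R" "k' \<in> proj_line R"
    using xy by (auto simp: x y)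
  \<comment> \<open>The test matrices are nilpotent: one on the line \<open>k\<close>, then one on the line \<open>i\<close>.\<close>
  have "k = k'"
    using rank_one_mult_eq_zero_iff[of c c i k k k] rank_one_mult_eq_zero_iff[of c' c i' k' k k] eq c P
    by simp
  moreover have "i = i'"
    using rank_one_mult_eq_zero_iff[of c c i i i k] rank_one_mult_eq_zero_iff[of c c' i i i' k'] eq c P
    by simp
  moreover have "c = c'"
  proof -
    obtain v\<^sub>1 v\<^sub>2 where v: "direction i = (v\<^sub>1, v\<^sub>2)" "v\<^sub>1 \<in> carrier R" "v\<^sub>2 \<in> carrier R"
      "v\<^sub>1 \<noteq> \<zero> \<or> v\<^sub>2 \<noteq> \<zero>" by (rule directionE[OF P(1)])
    obtain w\<^sub>1 w\<^sub>2 where w: "annihilator k = (w\<^sub>1, w\<^sub>2)" "w\<^sub>1 \<in> carrier R" "w\<^sub>2 \<in> carrier R"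
      "w\<^sub>1 \<noteq> \<zero> \<or> w\<^sub>2 \<noteq> \<zero>" by (rule annihilatorE[OF P(2)])
    obtain z where "z \<in> carrier R" "z \<noteq> \<zero>" "c \<otimes> z = c' \<otimes> z"
      using eq v w \<open>k = k'\<close> \<open>i = i'\<close> by (auto simp: rank_one_def) (metis integral_iff m_closed)+
    then show ?thesis using c m_rcancel by simp
  qed
  ultimately show "x = y" by (simp add: x y)
qed

text \<open>The second column tells the two kinds of kernel apart, since it is zero exactly for the kernel
\<open>None\<close>; in the remaining cases the first nonzero entry of a nonzero column fixes the scalar up to sign
and tells the two kinds of image apart.\<close>

lemma (in field) singular_imp_rank_one:
  assumes "a \<in> carrier R" "b \<in> carrier R" "c \<in> carrier R" "d \<in> carrier R"
    and det: "a \<otimes> d = b \<otimes> c" and nz: "(a, b, c, d) \<noteq> \<zero>\<^bsub>mat2_ring R\<^esub>"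
  shows "(a, b, c, d) \<in> rank_one ` ((carrier R - {\<zero>}) \<times> proj_line R \<times> proj_line R)"
proof -
  note [simp] = assms(1-4)
  let ?D = "(carrier R - {\<zero>}) \<times> proj_line R \<times> proj_line R"
  have neg: "\<ominus> x \<noteq> \<zero>" if "x \<in> carrier R" "x \<noteq> \<zero>" for x
    using that neg_equal_swap[of x \<zero>] by simp
  have cancel: "x \<otimes> (inv x \<otimes> y) = y" if "x \<in> carrier R" "x \<noteq> \<zero>" "y \<in> carrier R" for x y
    using that by (simp flip: m_assoc)
  consider "b \<noteq> \<zero>" | "b = \<zero>" "d \<noteq> \<zero>" | "b = \<zero>" "d = \<zero>" "a \<noteq> \<zero>"
    | "b = \<zero>" "d = \<zero>" "a = \<zero>" "c \<noteq> \<zero>"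
    using nz by (auto simp: mat2_ring_def)
  then show ?thesis
  proof cases
    case 1
    let ?x = "(\<ominus> b, Some (inv b \<otimes> d), Some (\<ominus> (inv b \<otimes> a)))"
    have "b \<otimes> (inv b \<otimes> d \<otimes> (inv b \<otimes> a)) = b \<otimes> (inv b \<otimes> d) \<otimes> (inv b \<otimes> a)"
      using 1 by (simp add: m_assoc)
    also have "\<dots> = inv b \<otimes> (a \<otimes> d)" using 1 by (simp add: cancel) (simp add: m_ac)
    also have "\<dots> = inv b \<otimes> b \<otimes> c" using 1 by (simp add: det m_assoc del: l_inv)
    also have "\<dots> = c" using 1 by simp
    finally have "b \<otimes> (inv b \<otimes> d \<otimes> (inv b \<otimes> a)) = c" .
    then have "rank_one ?x = (a, b, c, d)"
      using 1 by (simp add: rank_one_def direction_def annihilator_def l_minus r_minus cancel)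
    moreover have "?x \<in> ?D" using 1 neg by (auto simp: proj_line_def)
    ultimately show ?thesis by (rule image_eqI[OF sym])
  next
    case 2
    let ?x = "(\<ominus> d, None, Some (\<ominus> (inv d \<otimes> c)))"
    have "a = \<zero>" using det 2 by (simp add: integral_iff)
    then have "rank_one ?x = (a, b, c, d)"
      using 2 by (simp add: rank_one_def direction_def annihilator_def l_minus r_minus cancel)
    moreover have "?x \<in> ?D" using 2 neg by (auto simp: proj_line_def)
    ultimately show ?thesis by (rule image_eqI[OF sym])
  next
    case 3
    let ?x = "(a, Some (inv a \<otimes> c), None)"
    have "rank_one ?x = (a, b, c, d)"
      using 3 by (simp add: rank_one_def direction_def annihilator_def cancel)
    moreover have "?x \<in> ?D" using 3 by (auto simp: proj_line_def)
    ultimately show ?thesis by (rule image_eqI[OF sym])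
  next
    case 4
    let ?x = "(c, None, None)"
    have "rank_one ?x = (a, b, c, d)"
      using 4 by (simp add: rank_one_def direction_def annihilator_def)
    moreover have "?x \<in> ?D" using 4 by (auto simp: proj_line_def)
    ultimately show ?thesis by (rule image_eqI[OF sym])
  qed
qed

text \<open>Multiplying by the adjugate shows that the determinant annihilates every kernel vector.\<close>

lemma (in domain) det_eq_zero_of_kernel:
  assumes "a \<in> carrier R" "b \<in> carrier R" "c \<in> carrier R" "d \<in> carrier R"
    and x: "x \<in> carrier R" "y \<in> carrier R" "x \<noteq> \<zero> \<or> y \<noteq> \<zero>"
    and ker: "a \<otimes> x \<oplus> b \<otimes> y = \<zero>" "c \<otimes> x \<oplus> d \<otimes> y = \<zero>"
  shows "a \<otimes> d = b \<otimes> c"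
proof -
  note carr [simp] = assms(1-4) x(1,2)
  have "(a \<otimes> d \<ominus> b \<otimes> c) \<otimes> x \<ominus> (d \<otimes> (a \<otimes> x \<oplus> b \<otimes> y) \<ominus> b \<otimes> (c \<otimes> x \<oplus> d \<otimes> y)) = \<zero>"
    using carr by algebra
  moreover have "(a \<otimes> d \<ominus> b \<otimes> c) \<otimes> y \<ominus> (a \<otimes> (c \<otimes> x \<oplus> d \<otimes> y) \<ominus> c \<otimes> (a \<otimes> x \<oplus> b \<otimes> y)) = \<zero>"
    using carr by algebra
  ultimately have "(a \<otimes> d \<ominus> b \<otimes> c) \<otimes> x = \<zero>" "(a \<otimes> d \<ominus> b \<otimes> c) \<otimes> y = \<zero>"
    by (simp_all add: ker)
  then show ?thesis using x by (auto simp: integral_iff eq_diff0)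
qed

text \<open>If \<open>x y = 0\<close>, a nonzero column of \<open>y\<close> lies in the kernel of \<open>x\<close>; if \<open>y x = 0\<close>, a nonzero row of
\<open>y\<close> lies in the kernel of the transpose of \<open>x\<close>. Either way \<open>x\<close> is singular. Conversely a matrix
with kernel \<open>k\<close> is annihilated on the right by the nilpotent matrix with image and kernel \<open>k\<close>.\<close>

lemma (in field) zero_divisors_mat2_ring:
  "zero_divisors (mat2_ring R) = rank_one ` ((carrier R - {\<zero>}) \<times> proj_line R \<times> proj_line R)"
proof (intro equalityI subsetI)
  fix x assume x: "x \<in> zero_divisors (mat2_ring R)"
  then obtain y where y: "y \<in> carrier (mat2_ring R)" "y \<noteq> \<zero>\<^bsub>mat2_ring R\<^esub>"
      and xy: "x \<otimes>\<^bsub>mat2_ring R\<^esub> y = \<zero>\<^bsub>mat2_ring R\<^esub> \<or> y \<otimes>\<^bsub>mat2_ring R\<^esub> x = \<zero>\<^bsub>mat2_ring R\<^esub>"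
    by (auto simp: zero_divisors_def)
  obtain a b c d where xe: "x = (a, b, c, d)"
      and X: "a \<in> carrier R" "b \<in> carrier R" "c \<in> carrier R" "d \<in> carrier R"
    using x by (auto simp: zero_divisors_def mat2_ring_def)
  obtain a' b' c' d' where ye: "y = (a', b', c', d')"
      and Y: "a' \<in> carrier R" "b' \<in> carrier R" "c' \<in> carrier R" "d' \<in> carrier R"
    using y by (auto simp: mat2_ring_def)
  have ynz: "(a' \<noteq> \<zero> \<or> c' \<noteq> \<zero>) \<or> (b' \<noteq> \<zero> \<or> d' \<noteq> \<zero>)"
    using y by (auto simp: ye mat2_ring_def)
  have "a \<otimes> d = b \<otimes> c"
  proof (cases "x \<otimes>\<^bsub>mat2_ring R\<^esub> y = \<zero>\<^bsub>mat2_ring R\<^esub>")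
    case True
    then show ?thesis
      using ynz det_eq_zero_of_kernel[OF X, of a' c'] det_eq_zero_of_kernel[OF X, of b' d'] Y
      by (auto simp: xe ye mat2_ring_def)
  next
    case False
    then have "y \<otimes>\<^bsub>mat2_ring R\<^esub> x = \<zero>\<^bsub>mat2_ring R\<^esub>" using xy by simp
    then have "a \<otimes> a' \<oplus> c \<otimes> b' = \<zero>" "b \<otimes> a' \<oplus> d \<otimes> b' = \<zero>"
        "a \<otimes> c' \<oplus> c \<otimes> d' = \<zero>" "b \<otimes> c' \<oplus> d \<otimes> d' = \<zero>"
      using X Y by (auto simp: xe ye mat2_ring_def m_comm)
    then have "a \<otimes> d = c \<otimes> b"
      using ynz det_eq_zero_of_kernel[OF X(1,3,2,4), of a' b']
        det_eq_zero_of_kernel[OF X(1,3,2,4), of c' d'] Y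
      by blast
    then show ?thesis using X by (simp add: m_comm)
  qed
  then show "x \<in> rank_one ` ((carrier R - {\<zero>}) \<times> proj_line R \<times> proj_line R)"
    using singular_imp_rank_one X x by (auto simp: xe zero_divisors_def)
next
  fix x assume "x \<in> rank_one ` ((carrier R - {\<zero>}) \<times> proj_line R \<times> proj_line R)"
  then obtain c i k where x: "x = rank_one (c, i, k)" "c \<in> carrier R - {\<zero>}"
      "i \<in> proj_line R" "k \<in> proj_line R" by auto
  then have "x \<otimes>\<^bsub>mat2_ring R\<^esub> rank_one (c, k, k) = \<zero>\<^bsub>mat2_ring R\<^esub>"
    using rank_one_mult_eq_zero_iff by simp
  moreover have "rank_one (c, k, k) \<in> carrier (mat2_ring R) - {\<zero>\<^bsub>mat2_ring R\<^esub>}"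
    "x \<in> carrier (mat2_ring R) - {\<zero>\<^bsub>mat2_ring R\<^esub>}"
    using x rank_one_nonzero[of c] rank_one_closed[of c] by auto
  ultimately show "x \<in> zero_divisors (mat2_ring R)" unfolding zero_divisors_def by blast
qed

section \<open>The independence number of the zero-divisor graph\<close>

lemma doubleton_in_zero_divisor_edges_iff:
  assumes "x \<noteq> y"
  shows "{x, y} \<in> zero_divisor_edges R \<longleftrightarrow> x \<in> zero_divisors R \<and> y \<in> zero_divisors R \<and>
    (x \<otimes>\<^bsub>R\<^esub> y = \<zero>\<^bsub>R\<^esub> \<or> y \<otimes>\<^bsub>R\<^esub> x = \<zero>\<^bsub>R\<^esub>)"
  using assms unfolding zero_divisor_edges_def by (auto simp: doubleton_eq_iff)

lemma doubleton_in_meeting_edges_iff: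
  assumes "(c, i, k) \<in> C \<times> P \<times> P" "(c', i', k') \<in> C \<times> P \<times> P" "(c, i, k) \<noteq> (c', i', k')"
  shows "{(c, i, k), (c', i', k')} \<in> meeting_edges C P \<longleftrightarrow> k = i' \<or> k' = i"
proof
  assume "{(c, i, k), (c', i', k')} \<in> meeting_edges C P"
  then show "k = i' \<or> k' = i" unfolding meeting_edges_def by (auto simp: doubleton_eq_iff)
next
  assume "k = i' \<or> k' = i"
  then show "{(c, i, k), (c', i', k')} \<in> meeting_edges C P"
    using assms unfolding meeting_edges_def by blast
qed

lemma (in field) independence_number_mat2_ring:
  "independence_number (zero_divisors (mat2_ring R)) (zero_divisor_edges (mat2_ring R))
   = independence_number ((carrier R - {\<zero>}) \<times> proj_line R \<times> proj_line R)
       (meeting_edges (carrier R - {\<zero>}) (proj_line R))"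
proof (rule independence_number_bij)
  let ?D = "(carrier R - {\<zero>}) \<times> proj_line R \<times> proj_line R"
  show "bij_betw rank_one ?D (zero_divisors (mat2_ring R))"
    using inj_on_rank_one zero_divisors_mat2_ring by (simp add: bij_betw_def)
  fix x y assume x: "x \<in> ?D" and y: "y \<in> ?D" and "x \<noteq> y"
  then have "rank_one x \<noteq> rank_one y" using inj_on_rank_one by (meson inj_onD)
  obtain c i k c' i' k' where eq: "x = (c, i, k)" "y = (c', i', k')" by (metis prod_cases3)
  have D: "c \<in> carrier R - {\<zero>}" "c' \<in> carrier R - {\<zero>}" "i \<in> proj_line R" "k \<in> proj_line R"
    "i' \<in> proj_line R" "k' \<in> proj_line R"
    using x y by (auto simp: eq)
  have "rank_one x \<in> zero_divisors (mat2_ring R)" "rank_one y \<in> zero_divisors (mat2_ring R)"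
    unfolding zero_divisors_mat2_ring using x y by blast+
  then have "{rank_one x, rank_one y} \<in> zero_divisor_edges (mat2_ring R) \<longleftrightarrow> k = i' \<or> k' = i"
    using doubleton_in_zero_divisor_edges_iff[OF \<open>rank_one x \<noteq> rank_one y\<close>, of "mat2_ring R"]
      rank_one_mult_eq_zero_iff[OF D] rank_one_mult_eq_zero_iff[OF D(2,1,5,6,3,4)]
    unfolding eq by blast
  then show "{rank_one x, rank_one y} \<in> zero_divisor_edges (mat2_ring R)
      \<longleftrightarrow> {x, y} \<in> meeting_edges (carrier R - {\<zero>}) (proj_line R)"
    using doubleton_in_meeting_edges_iff[OF x[unfolded eq] y[unfolded eq] \<open>x \<noteq> y\<close>[unfolded eq]]
    unfolding eq by simp
qed

lemma independence_number_zero_divisors_iso: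
  assumes "ring R" "ring S" and h: "h \<in> ring_iso R S"
  shows "independence_number (zero_divisors S) (zero_divisor_edges S)
       = independence_number (zero_divisors R) (zero_divisor_edges R)"
proof (rule independence_number_bij)
  have bij: "bij_betw h (carrier R) (carrier S)" and hom: "h \<in> ring_hom R S"
    using h by (auto simp: ring_iso_def)
  have inj: "inj_on h (carrier R)" and im: "h ` carrier R = carrier S"
    using bij by (auto simp: bij_betw_def)
  have zero: "h \<zero>\<^bsub>R\<^esub> = \<zero>\<^bsub>S\<^esub>" "\<zero>\<^bsub>R\<^esub> \<in> carrier R"
    using ring_hom_zero[OF hom assms(1,2)] ring.ring_simprules(2)[OF assms(1)] by auto
  have eq_zero: "h x = \<zero>\<^bsub>S\<^esub> \<longleftrightarrow> x = \<zero>\<^bsub>R\<^esub>" if "x \<in> carrier R" for x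
    using inj_on_eq_iff[OF inj that zero(2)] zero(1) by simp
  have mult: "h x \<otimes>\<^bsub>S\<^esub> h y = \<zero>\<^bsub>S\<^esub> \<longleftrightarrow> x \<otimes>\<^bsub>R\<^esub> y = \<zero>\<^bsub>R\<^esub>"
    if "x \<in> carrier R" "y \<in> carrier R" for x y
    using ring_hom_mult[OF hom that] eq_zero[OF ring.ring_simprules(5)[OF assms(1) that]] by metis
  have zd: "h x \<in> zero_divisors S \<longleftrightarrow> x \<in> zero_divisors R" if "x \<in> carrier R" for x
    using that im eq_zero mult unfolding zero_divisors_def by (auto simp flip: im)
  have sub: "zero_divisors R \<subseteq> carrier R" "zero_divisors S \<subseteq> carrier S"
    by (auto simp: zero_divisors_def)
  have "h ` zero_divisors R = zero_divisors S"
    using zd sub im by (auto 0 3 simp: image_iff)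
  then show "bij_betw h (zero_divisors R) (zero_divisors S)"
    using inj_on_subset[OF inj sub(1)] by (simp add: bij_betw_def)
  fix x y assume xy: "x \<in> zero_divisors R" "y \<in> zero_divisors R" "x \<noteq> y"
  then have "h x \<noteq> h y" using inj sub by (meson inj_onD subsetD)
  then show "{h x, h y} \<in> zero_divisor_edges S \<longleftrightarrow> {x, y} \<in> zero_divisor_edges R"
    using xy mult zd sub by (simp add: doubleton_in_zero_divisor_edges_iff subset_iff)
qed

text \<open>With \<open>q\<close> the order of the field there are \<open>q - 1\<close> scalars and \<open>q + 1\<close> lines, so the set of
lines splits into halves of size \<open>(q + 1) / 2\<close>.\<close>

lemma (in field) independence_number_quaternion_ring:
  assumes fin: "finite (carrier R)" and odd: "odd (card (carrier R))"
  shows "independence_number (zero_divisors (quaternion_ring R))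
           (zero_divisor_edges (quaternion_ring R))
       = (card (carrier R) - 1) * ((card (carrier R) + 1) div 2)\<^sup>2"
proof -
  let ?C = "carrier R - {\<zero>}" and ?Q = "quaternion_ring R"
  obtain u v where uv: "u \<in> carrier R" "v \<in> carrier R" "u \<otimes> u \<oplus> v \<otimes> v = \<ominus> \<one>"
    using sum_of_two_squares_eq_minus_one[OF fin odd] .
  have "card {\<zero>, \<one>} \<le> card (carrier R)" using fin by (intro card_mono) auto
  then have "2 \<le> card (carrier R)" by simp
  moreover obtain r where r: "card (carrier R) = 2 * r + 1" using odd by (rule oddE)
  ultimately have "2 \<le> card ?C" using fin by simp
  have "independence_number (zero_divisors ?Q) (zero_divisor_edges ?Q)
      = independence_number (zero_divisors (mat2_ring R)) (zero_divisor_edges (mat2_ring R))"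
    using independence_number_zero_divisors_iso[OF ring_quaternion_ring ring_mat2_ring
        quaternion_ring_iso_mat2_ring[OF uv two_nonzero_of_odd_card[OF odd]]] by simp
  also have "\<dots> = independence_number (?C \<times> proj_line R \<times> proj_line R) (meeting_edges ?C (proj_line R))"
    by (rule independence_number_mat2_ring)
  also have "\<dots> = card ?C * (r + 1)\<^sup>2"
    using fin \<open>2 \<le> card ?C\<close> r card_proj_line
    by (intro independence_number_meeting_edges) (auto simp: proj_line_def)
  finally show ?thesis using fin r by simp
qed

theorem theorem3p7:
  fixes p :: nat
  assumes "prime p" and "odd p"
  shows "real (independence_number (zero_divisors (lipschitz_ring p))
                 (zero_divisor_edges (lipschitz_ring p)))
       = (real p - 1) * (real p + 1)^2 / 4"
proof -
  interpret residues_prime p "residue_ring (int p)"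
    by unfold_locales (rule assms(1))
  have card: "card (carrier (residue_ring (int p))) = p"
    by (simp add: residue_ring_def)
  obtain r where r: "p = 2 * r + 1" using assms(2) by (rule oddE)
  have "finite (carrier (residue_ring (int p)))" by (simp add: residue_ring_def)
  then have "independence_number (zero_divisors (lipschitz_ring p)) (zero_divisor_edges (lipschitz_ring p))
      = (p - 1) * ((p + 1) div 2)\<^sup>2"
    using independence_number_quaternion_ring assms(2) unfolding lipschitz_ring_def card by blast
  also have "\<dots> = 2 * r * (r + 1)\<^sup>2" by (simp add: r)
  finally have "real (independence_number (zero_divisors (lipschitz_ring p))
      (zero_divisor_edges (lipschitz_ring p))) = 2 * real r * (real r + 1)\<^sup>2" by simp
  \<comment> \<open>Unqualified, \<open>power2_eq_square\<close> would denote the fact about the interpreted residue ring.\<close>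
  also have "\<dots> = (real p - 1) * (real p + 1)^2 / 4"
    by (simp add: r monoid_mult_class.power2_eq_square algebra_simps)
  finally show ?thesis .
qed

end
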